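(* For each $j\in\mathbb{N}$ let $\phi_j\colon[0,1]^2\to[0,\infty)$ be the continuous density of a copula in $\mathbb{R}^2$, and for each $k\in\mathbb{N}\setminus\{1\}$ let $c_k\colon[0,1]^k\to[0,\infty)$ be the density of a copula of the form $$c_k(u_1,\dots,u_k)=\phi_1(u_1,u_2)\,\phi_2(u_2,u_3)\cdots\phi_{k-1}(u_{k-1},u_k)\quad\text{for all }u_1,\dots,u_k\in[0,1].$$ Then the following are equivalent: (1) the family $(c_k)_{k\in\mathbb{N}\setminus\{1\}}$ is uniformly integrable; (2) $\displaystyle\sum_{j=1}^\infty\Big(1-\int_{[0,1]^2}\sqrt{\phi_j(u,v)}\,du\,dv\Big)<\infty.$
   Context: $\mathbb{N}=\{1,2,\dots\}$. A copula in $\mathbb{R}^k$ is a cumulative distribution function $C_k\colon[0,1]^k\to[0,1]$ (i.e. the restriction to $[0,1]^k$ of the distribution function of a probability measure on $[0,1]^k$) with uniform marginals: $C_k(1,\dots,1,u_j,1,\dots,1)=u_j$ for all $u_j\in[0,1]$, $j\in\{1,\dots,k\}$. It has density $c_k$ if $c_k\colon[0,1]^k\to[0,\infty)$ is measurable and $C_k(u_1,\dots,u_k)=\int_0^{u_1}\cdots\int_0^{u_k}c_k(v_1,\dots,v_k)\,dv_k\cdots dv_1$ for all $u_1,\dots,u_k\in[0,1]$. The family $(c_k)_{k\in\mathbb{N}\setminus\{1\}}$ is called uniformly integrable if $$\lim_{r\to\infty}\sup_{k\in\mathbb{N}\setminus\{1\}}\int_{\{u\in[0,1]^k:\,c_k(u)\ge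 r\}}c_k(u)\,du=0.$$ *)

theory Defs
  imports "HOL-Probability.Probability"
begin

text \<open>
  Points of the unit cube \<open>[0,1]\<^sup>k\<close> are the extensional functions in
  \<open>{1..k} \<rightarrow>\<^sub>E {0..1}\<close>, which is the space of the following measure
  (Lebesgue measure on the Borel subsets of the cube).
\<close>

definition unit_cube :: "nat \<Rightarrow> (nat \<Rightarrow> real) measure" where
  "unit_cube k = PiM {1..k} (\<lambda>_. restrict_space lborel {0..1})"

definition lower_box :: "nat \<Rightarrow> (nat \<Rightarrow> real) \<Rightarrow> (nat \<Rightarrow> real) set" where
  "lower_box k u = {x \<in> space (unit_cube k). \<forall>i\<in>{1..k}. x i \<le> u i}"

text \<open>The values of \<open>C\<close> outside the cube are irrelevant.\<close>

definition copula :: "nat \<Rightarrow> ((nat \<Rightarrow> real) \<Rightarrow> real) \<Rightarrow> bool" where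
  "copula k C \<longleftrightarrow>
     (\<exists>M. prob_space M \<and> sets M = sets (unit_cube k) \<and>
        (\<forall>u\<in>space (unit_cube k). C u = measure M (lower_box k u))) \<and>
     (\<forall>j\<in>{1..k}. \<forall>t\<in>{0..1}. C (\<lambda>i\<in>{1..k}. if i = j then t else 1) = t)"

text \<open>
  The iterated integral over \<open>[0,u\<^sub>1] \<times> \<dots> \<times> [0,u\<^sub>k]\<close> of the nonnegative function \<open>c\<close>
  is written as an integral with respect to the product measure.
\<close>

definition has_copula_density ::
    "nat \<Rightarrow> ((nat \<Rightarrow> real) \<Rightarrow> real) \<Rightarrow> ((nat \<Rightarrow> real) \<Rightarrow> real) \<Rightarrow> bool" where
  "has_copula_density k C c \<longleftrightarrow>
     c \<in> borel_measurable (unit_cube k) \<and>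
     (\<forall>u\<in>space (unit_cube k). 0 \<le> c u) \<and>
     (\<forall>u\<in>space (unit_cube k).
        ennreal (C u) = (\<integral>\<^sup>+v\<in>lower_box k u. ennreal (c v) \<partial>unit_cube k))"

definition copula_density :: "nat \<Rightarrow> ((nat \<Rightarrow> real) \<Rightarrow> real) \<Rightarrow> bool" where
  "copula_density k c \<longleftrightarrow> (\<exists>C. copula k C \<and> has_copula_density k C c)"

text \<open>The family is indexed by \<open>k \<ge> 2\<close>; the supremum and the limit are taken in \<open>[0,\<infinity>]\<close>.\<close>

definition uniformly_integrable :: "(nat \<Rightarrow> (nat \<Rightarrow> real) \<Rightarrow> real) \<Rightarrow> bool" where
  "uniformly_integrable c \<longleftrightarrow>
     ((\<lambda>r::real. SUP k\<in>{2..}.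
         \<integral>\<^sup>+u\<in>{u \<in> space (unit_cube k). c k u \<ge> r}. ennreal (c k u) \<partial>unit_cube k)
       \<longlongrightarrow> 0) at_top"

end

theory Submission
  imports Defs
begin

text \<open>
  Under \<open>c\<^sub>k du\<close> the coordinates form a Markov chain with uniform marginals, and under \<open>du\<close> they
  are independent and uniform. Put \<open>g\<^sub>j(x) = \<integral> \<surd>\<phi>\<^sub>j(x,v) dv\<close>, so that \<open>1 - \<integral> g\<^sub>j\<close> is the \<open>j\<close>-th term
  of the series.

  If the series converges, compare \<open>c\<^sub>k\<close> with \<open>c\<^sub>m\<close>, regarded as a density on the \<open>k\<close>-cube. Since
  \<open>\<surd>(c\<^sub>k c\<^sub>m) \<le> (c\<^sub>k + c\<^sub>m) / 2\<close> and both densities have uniform marginals, the \<open>j\<close>-th step decreases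
  the Hellinger integral \<open>\<integral> \<surd>(c\<^sub>k c\<^sub>m)\<close> by at most the \<open>j\<close>-th term, so it stays above one minus a
  tail of the series. On \<open>{c\<^sub>k \<ge> 4 c\<^sub>m}\<close> one has \<open>c\<^sub>k \<le> 4 (\<surd>c\<^sub>k - \<surd>c\<^sub>m)\<^sup>2\<close>, and \<open>c\<^sub>m\<close> is bounded
  by continuity.

  Conversely, write \<open>\<surd>c\<^sub>k = a b\<close> with \<open>b = \<Prod>\<^sub>j exp (g\<^sub>j(u\<^sub>j) - 1)\<close>. As \<open>g exp (1 - g) \<le> 1\<close>, the
  factor \<open>a\<close> has integral at most 1, while by independence \<open>\<integral> b \<le> exp (- s / 2)\<close> with \<open>s\<close> the partial sum
  of the series. On \<open>{c\<^sub>k < r}\<close> the density is at most a linear combination of \<open>a\<close> and \<open>b\<close>, so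
  \<open>\<integral> c\<^sub>k = 1\<close> and uniform integrability bound \<open>s\<close>.
\<close>

section \<open>Products of two-variable factors along a path\<close>

definition path_density :: "(nat \<Rightarrow> 'a \<times> 'a \<Rightarrow> real) \<Rightarrow> nat \<Rightarrow> (nat \<Rightarrow> 'a) \<Rightarrow> real" where
  "path_density \<phi> k x = (\<Prod>j=1..<k. \<phi> j (x j, x (j + 1)))"

lemma path_density_Suc:
  "k \<ge> 1 \<Longrightarrow> path_density \<phi> (Suc k) x = path_density \<phi> k x * \<phi> k (x k, x (Suc k))"
  by (simp add: path_density_def)

text \<open>The factors with index below \<open>k\<close> read coordinates up to \<open>k\<close>
  only. This independence of coordinate \<open>Suc k\<close> is what
  \<open>nn_integral_cube_Suc\<close> asks of its function \<open>h\<close>.\<close>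

lemma path_density_upd_Suc [simp]: "path_density \<phi> k (x(Suc k := y)) = path_density \<phi> k x"
  unfolding path_density_def by (intro prod.cong) auto

lemma path_density_nonneg: "(\<And>j p. 0 \<le> \<phi> j p) \<Longrightarrow> 0 \<le> path_density \<phi> k x"
  by (simp add: path_density_def prod_nonneg)

lemma path_density_sqrt:
  "path_density (\<lambda>j p. sqrt (\<phi> j p)) k x = sqrt (path_density \<phi> k x)"
  unfolding path_density_def by (induction k) (auto simp: real_sqrt_mult prod.atLeastLessThan_Suc)

lemma ennreal_half_mult_add_self: "ennreal (1/2) * (x + x) = x"
proof -
  have "ennreal (1/2) * 2 = 1"
    using ennreal_mult[of "1/2" 2] by (simp del: ennreal_half)
  then show ?thesis by (simp add: mult.assoc[symmetric] mult_2[symmetric] del: ennreal_half)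
qed

section \<open>Markov chains on the powers of a probability space\<close>

context prob_space
begin

definition cube :: "nat \<Rightarrow> (nat \<Rightarrow> 'a) measure" where
  "cube k = PiM {1..k} (\<lambda>_. M)"

lemma measurable_cube_component: "i \<in> {1..k} \<Longrightarrow> (\<lambda>x. x i) \<in> cube k \<rightarrow>\<^sub>M M"
  unfolding cube_def by (rule measurable_component_singleton)

text \<open>These are the transition densities that leave \<open>M\<close> invariant. A copula fixes
  its marginal densities only up to null sets, hence \<open>AE\<close> for the marginals.
  Nonnegativity holds everywhere, so products and square roots need no exceptional sets.\<close>

definition doubly_stochastic :: "('a \<times> 'a \<Rightarrow> real) \<Rightarrow> bool" where
  "doubly_stochastic f \<longleftrightarrow>
     f \<in> borel_measurable (M \<Otimes>\<^sub>M M) \<and> (\<forall>p. 0 \<le> f p) \<and>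
     (AE x in M. (\<integral>\<^sup>+y. ennreal (f (x, y)) \<partial>M) = 1) \<and>
     (AE y in M. (\<integral>\<^sup>+x. ennreal (f (x, y)) \<partial>M) = 1)"

lemma doubly_stochasticD:
  assumes "doubly_stochastic f"
  shows "f \<in> borel_measurable (M \<Otimes>\<^sub>M M)" and "0 \<le> f p"
    and "AE x in M. (\<integral>\<^sup>+y. ennreal (f (x, y)) \<partial>M) = 1"
    and "AE y in M. (\<integral>\<^sup>+x. ennreal (f (x, y)) \<partial>M) = 1"
  using assms unfolding doubly_stochastic_def by blast+

lemma doubly_stochastic_const_1: "doubly_stochastic (\<lambda>_. 1)"
  by (simp add: doubly_stochastic_def emeasure_space_1)

lemma product_prob_space_const: "product_prob_space (\<lambda>_. M)"
  by (simp add: product_prob_space_def product_prob_space_axioms_def product_sigma_finite_def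
      prob_space_axioms sigma_finite_measure_axioms)

lemma pair_sigma_finite_self: "pair_sigma_finite M M"
  by (simp add: pair_sigma_finite_def sigma_finite_measure_axioms)

lemma AE_cube_component:
  assumes "AE x in M. P x" "i \<in> {1..k}"
  shows "AE x in cube k. P (x i)"
  unfolding cube_def by (rule AE_PiM_component) (use assms prob_space_axioms in auto)

lemma measurable_path_density:
  assumes [measurable]: "\<And>j. \<phi> j \<in> borel_measurable (M \<Otimes>\<^sub>M M)" and "k \<le> n"
  shows "path_density \<phi> k \<in> borel_measurable (cube n)"
  unfolding path_density_def
proof (rule borel_measurable_prod)
  fix j assume "j \<in> {1..<k}"
  then have [measurable]: "(\<lambda>x. x j) \<in> cube n \<rightarrow>\<^sub>M M" "(\<lambda>x. x (j + 1)) \<in> cube n \<rightarrow>\<^sub>M M"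
    using assms(2) by (auto intro!: measurable_cube_component)
  show "(\<lambda>x. \<phi> j (x j, x (j + 1))) \<in> borel_measurable (cube n)" by measurable
qed

lemma nn_integral_cube_1:
  assumes "f \<in> borel_measurable M"
  shows "(\<integral>\<^sup>+x. f (x (1::nat)) \<partial>cube 1) = (\<integral>\<^sup>+x. f x \<partial>M)"
proof -
  interpret P: product_prob_space "\<lambda>_::nat. M" "{}" by (rule product_prob_space_const)
  show ?thesis using P.product_nn_integral_singleton[OF assms, of 1] by (simp add: cube_def)
qed

text \<open>Fubini for the last coordinate. Since \<open>h\<close> ignores that coordinate, it
  leaves the inner integral, and the same \<open>h\<close> can be integrated over both
  cubes.\<close>

lemma nn_integral_cube_Suc:
  assumes h: "h \<in> borel_measurable (cube (Suc k))" "\<And>x y. h (x(Suc k := y)) = h x"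
    and f[measurable]: "f \<in> borel_measurable (M \<Otimes>\<^sub>M M)" and k: "k \<ge> 1"
  shows "(\<integral>\<^sup>+x. h x * f (x k, x (Suc k)) \<partial>cube (Suc k)) =
         (\<integral>\<^sup>+x. h x * (\<integral>\<^sup>+y. f (x k, y) \<partial>M) \<partial>cube k)"
proof -
  interpret P: product_prob_space "\<lambda>_::nat. M" "{}" by (rule product_prob_space_const)
  have ins: "{1..Suc k} = insert (Suc k) {1..k}" by auto
  have [measurable]: "(\<lambda>x. x k) \<in> cube (Suc k) \<rightarrow>\<^sub>M M" "(\<lambda>x. x (Suc k)) \<in> cube (Suc k) \<rightarrow>\<^sub>M M"
    using k by (auto intro!: measurable_cube_component)
  note [measurable] = h(1)
  have "(\<lambda>x. h x * f (x k, x (Suc k))) \<in> borel_measurable (cube (Suc k))" by measurable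
  then have "(\<integral>\<^sup>+x. h x * f (x k, x (Suc k)) \<partial>cube (Suc k)) =
      (\<integral>\<^sup>+x. \<integral>\<^sup>+y. h x * f (x k, y) \<partial>M \<partial>cube k)"
    unfolding cube_def ins using P.product_nn_integral_insert[of "{1..k}" "Suc k"] by (simp add: h(2))
  also have "\<dots> = (\<integral>\<^sup>+x. h x * (\<integral>\<^sup>+y. f (x k, y) \<partial>M) \<partial>cube k)"
  proof (rule nn_integral_cong)
    fix x assume "x \<in> space (cube k)"
    then have [measurable]: "x k \<in> space M" using k by (auto simp: cube_def space_PiM)
    show "(\<integral>\<^sup>+y. h x * f (x k, y) \<partial>M) = h x * (\<integral>\<^sup>+y. f (x k, y) \<partial>M)"
      by (rule nn_integral_cmult) measurable
  qed
  finally show ?thesis .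
qed

lemma nn_integral_cube_2:
  assumes [measurable]: "f \<in> borel_measurable (M \<Otimes>\<^sub>M M)"
  shows "(\<integral>\<^sup>+x. f (x (1::nat), x 2) \<partial>cube 2) = (\<integral>\<^sup>+x. \<integral>\<^sup>+y. f (x, y) \<partial>M \<partial>M)"
  using nn_integral_cube_Suc[of "\<lambda>_. 1" 1 f] nn_integral_cube_1[of "\<lambda>x. \<integral>\<^sup>+y. f (x, y) \<partial>M"]
  by (simp add: numeral_2_eq_2)

text \<open>The chain starts with law \<open>M\<close>, and each transition preserves this law. The
  test function \<open>h\<close> is arbitrary in the induction because the induction hypothesis is
  applied to its image under the transition operator.\<close>

lemma nn_integral_path_density_marginal:
  assumes ds: "\<And>j. doubly_stochastic (\<phi> j)" and "k \<ge> 1" and "h \<in> borel_measurable M"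
  shows "(\<integral>\<^sup>+x. ennreal (path_density \<phi> k x) * h (x k) \<partial>cube k) = (\<integral>\<^sup>+x. h x \<partial>M)"
  using assms(2,3)
proof (induction k arbitrary: h rule: dec_induct)
  case base
  then show ?case by (simp add: path_density_def nn_integral_cube_1[simplified])
next
  case (step k)
  note [measurable] = doubly_stochasticD(1)[OF ds] and nn = doubly_stochasticD(2)[OF ds]
  note [measurable] = step.prems
  have "(\<integral>\<^sup>+x. ennreal (path_density \<phi> (Suc k) x) * h (x (Suc k)) \<partial>cube (Suc k)) =
      (\<integral>\<^sup>+x. ennreal (path_density \<phi> k x) *
         (case (x k, x (Suc k)) of (u, v) \<Rightarrow> ennreal (\<phi> k (u, v)) * h v) \<partial>cube (Suc k))"
    using step.hyps by (simp add: path_density_Suc ennreal_mult' path_density_nonneg nn ac_simps)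
  also have "\<dots> = (\<integral>\<^sup>+x. ennreal (path_density \<phi> k x) *
      (\<integral>\<^sup>+y. ennreal (\<phi> k (x k, y)) * h y \<partial>M) \<partial>cube k)"
    using step.hyps measurable_path_density[of \<phi> k "Suc k"]
    by (subst nn_integral_cube_Suc) auto
  also have "\<dots> = (\<integral>\<^sup>+x. \<integral>\<^sup>+y. ennreal (\<phi> k (x, y)) * h y \<partial>M \<partial>M)"
    by (rule step.IH) measurable
  also have "\<dots> = (\<integral>\<^sup>+y. \<integral>\<^sup>+x. ennreal (\<phi> k (x, y)) * h y \<partial>M \<partial>M)"
    by (rule pair_sigma_finite.Fubini'[OF pair_sigma_finite_self, symmetric]) measurable
  also have "\<dots> = (\<integral>\<^sup>+y. h y \<partial>M)"
  proof (rule nn_integral_cong_AE)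
    have "AE y in M. (\<integral>\<^sup>+x. ennreal (\<phi> k (x, y)) \<partial>M) = 1"
      by (rule doubly_stochasticD(4)[OF ds])
    with AE_space show "AE y in M. (\<integral>\<^sup>+x. ennreal (\<phi> k (x, y)) * h y \<partial>M) = h y"
      by eventually_elim (simp add: nn_integral_multc)
  qed
  finally show ?case .
qed

text \<open>Sub-Markov kernels do not increase mass: coordinates are integrated out from the last
  one down. Only row integrals matter here, so the lemma also covers the normalised roots of
  densities, which are not doubly stochastic.\<close>

lemma nn_integral_path_density_le_1:
  assumes [measurable]: "\<And>j. \<kappa> j \<in> borel_measurable (M \<Otimes>\<^sub>M M)" and nn: "\<And>j p. 0 \<le> \<kappa> j p"
    and sub: "\<And>j. AE x in M. (\<integral>\<^sup>+y. ennreal (\<kappa> j (x, y)) \<partial>M) \<le> 1" and "k \<ge> 1"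
  shows "(\<integral>\<^sup>+x. ennreal (path_density \<kappa> k x) \<partial>cube k) \<le> 1"
  using assms(4)
proof (induction k rule: dec_induct)
  case base
  show ?case
    using nn_integral_cube_1[of "\<lambda>_. 1"] by (simp add: path_density_def emeasure_space_1)
next
  case (step k)
  have "(\<integral>\<^sup>+x. ennreal (path_density \<kappa> (Suc k) x) \<partial>cube (Suc k)) =
      (\<integral>\<^sup>+x. ennreal (path_density \<kappa> k x) * ennreal (\<kappa> k (x k, x (Suc k))) \<partial>cube (Suc k))"
    using step.hyps by (simp add: path_density_Suc ennreal_mult' path_density_nonneg nn)
  also have "\<dots> = (\<integral>\<^sup>+x. ennreal (path_density \<kappa> k x) *
      (\<integral>\<^sup>+y. ennreal (\<kappa> k (x k, y)) \<partial>M) \<partial>cube k)"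
    using step.hyps measurable_path_density[of \<kappa> k "Suc k"]
    by (subst nn_integral_cube_Suc[where f = "\<lambda>p. ennreal (\<kappa> k p)"]) auto
  also have "\<dots> \<le> (\<integral>\<^sup>+x. ennreal (path_density \<kappa> k x) \<partial>cube k)"
  proof (rule nn_integral_mono_AE)
    have "AE x in cube k. (\<integral>\<^sup>+y. ennreal (\<kappa> k (x k, y)) \<partial>M) \<le> 1"
      using AE_cube_component[OF sub, of k k k] step.hyps by auto
    then show "AE x in cube k. ennreal (path_density \<kappa> k x) *
        (\<integral>\<^sup>+y. ennreal (\<kappa> k (x k, y)) \<partial>M) \<le> ennreal (path_density \<kappa> k x)"
      by eventually_elim (metis mult.right_neutral mult_left_mono zero_le)
  qed
  also note step.IH
  finally show ?case .
qed

section \<open>Hellinger integrals of two chains\<close>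

definition affinity :: "('a \<times> 'a \<Rightarrow> real) \<Rightarrow> ('a \<times> 'a \<Rightarrow> real) \<Rightarrow> 'a \<Rightarrow> ennreal" where
  "affinity f g x = (\<integral>\<^sup>+y. ennreal (sqrt (f (x, y) * g (x, y))) \<partial>M)"

lemma measurable_affinity [measurable]:
  assumes [measurable]: "f \<in> borel_measurable (M \<Otimes>\<^sub>M M)" "g \<in> borel_measurable (M \<Otimes>\<^sub>M M)"
  shows "affinity f g \<in> borel_measurable M"
  unfolding affinity_def by measurable

text \<open>The geometric mean is at most the arithmetic mean, and both rows have integral 1.
  Consequently the truncated difference \<open>1 - affinity f g x\<close> is a true difference
  almost everywhere.\<close>

lemma affinity_le_1:
  assumes "doubly_stochastic f" "doubly_stochastic g"
  shows "AE x in M. affinity f g x \<le> 1"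
proof -
  note [measurable] = assms[THEN doubly_stochasticD(1)]
    and nn = assms[THEN doubly_stochasticD(2)]
  show ?thesis
    using AE_space assms[THEN doubly_stochasticD(3)]
  proof eventually_elim
    fix x assume [measurable]: "x \<in> space M"
      and 1: "(\<integral>\<^sup>+y. ennreal (f (x, y)) \<partial>M) = 1" "(\<integral>\<^sup>+y. ennreal (g (x, y)) \<partial>M) = 1"
    have "affinity f g x \<le> (\<integral>\<^sup>+y. ennreal (1/2) * (ennreal (f (x, y)) + ennreal (g (x, y))) \<partial>M)"
      unfolding affinity_def
    proof (rule nn_integral_mono)
      fix y
      show "ennreal (sqrt (f (x, y) * g (x, y))) \<le>
          ennreal (1/2) * (ennreal (f (x, y)) + ennreal (g (x, y)))"
        using arith_geo_mean_sqrt[of "f (x, y)" "g (x, y)"] nn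
        by (simp flip: ennreal_plus ennreal_mult del: ennreal_half)
    qed
    also have "\<dots> = ennreal (1/2) * (1 + 1)"
      by (simp add: nn_integral_cmult nn_integral_add 1 del: ennreal_half)
    also have "\<dots> = 1" by (rule ennreal_half_mult_add_self)
    finally show "affinity f g x \<le> 1" .
  qed
qed

text \<open>Each step of the chains costs at most the mean affinity defect of that step. The bound
  is stated additively to avoid truncated subtraction.\<close>

lemma one_le_hellinger_path_density:
  assumes ds: "\<And>j. doubly_stochastic (\<phi> j)" "\<And>j. doubly_stochastic (\<psi> j)" and "k \<ge> 1"
  shows "1 \<le> (\<integral>\<^sup>+x. ennreal (sqrt (path_density \<phi> k x * path_density \<psi> k x)) \<partial>cube k) +
      (\<Sum>j=1..<k. \<integral>\<^sup>+x. 1 - affinity (\<phi> j) (\<psi> j) x \<partial>M)"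
  using assms(3)
proof (induction k rule: dec_induct)
  case base
  show ?case
    using nn_integral_cube_1[of "\<lambda>_. 1"] by (simp add: path_density_def emeasure_space_1)
next
  case (step k)
  note [measurable] = doubly_stochasticD(1)[OF ds(1)] doubly_stochasticD(1)[OF ds(2)]
    and nn = doubly_stochasticD(2)[OF ds(1)] doubly_stochasticD(2)[OF ds(2)]
  let ?P = "path_density \<phi> k" and ?Q = "path_density \<psi> k"
  let ?D = "\<lambda>x. ennreal (sqrt (?P x * ?Q x))"
  let ?a = "affinity (\<phi> k) (\<psi> k)"
  let ?T = "\<integral>\<^sup>+x. 1 - ?a x \<partial>M"
  have [measurable]: "?P \<in> borel_measurable (cube k)" "?Q \<in> borel_measurable (cube k)"
      "?P \<in> borel_measurable (cube (Suc k))" "?Q \<in> borel_measurable (cube (Suc k))"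
    by (rule measurable_path_density[OF doubly_stochasticD(1)[OF ds(1)]] measurable_path_density[OF doubly_stochasticD(1)[OF ds(2)]], simp)+
  have [measurable]: "(\<lambda>x. x k) \<in> cube k \<rightarrow>\<^sub>M M"
    using step.hyps by (auto intro!: measurable_cube_component)
  have nnP: "0 \<le> ?P x" "0 \<le> ?Q x" for x by (auto intro!: path_density_nonneg nn)
  have "(\<integral>\<^sup>+x. ennreal (sqrt (path_density \<phi> (Suc k) x * path_density \<psi> (Suc k) x)) \<partial>cube (Suc k)) =
      (\<integral>\<^sup>+x. ?D x * ennreal (sqrt (\<phi> k (x k, x (Suc k)) * \<psi> k (x k, x (Suc k)))) \<partial>cube (Suc k))"
    using step.hyps nnP nn
    by (auto simp: path_density_Suc ac_simps real_sqrt_mult simp flip: ennreal_mult intro!: nn_integral_cong)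
  also have "\<dots> = (\<integral>\<^sup>+x. ?D x * ?a (x k) \<partial>cube k)"
    using step.hyps unfolding affinity_def
    by (intro nn_integral_cube_Suc[where f = "\<lambda>p. ennreal (sqrt (\<phi> k p * \<psi> k p))"]) simp_all
  finally have H: "(\<integral>\<^sup>+x. ennreal (sqrt (path_density \<phi> (Suc k) x * path_density \<psi> (Suc k) x))
      \<partial>cube (Suc k)) = (\<integral>\<^sup>+x. ?D x * ?a (x k) \<partial>cube k)" .
  \<comment> \<open>Split \<open>?D\<close> into \<open>?D * ?a\<close> and
    \<open>?D * (1 - ?a)\<close>. The first part is the Hellinger integral of the next step; in the
    second, \<open>?D\<close> is bounded by the mean of \<open>?P\<close> and
    \<open>?Q\<close>.\<close>
  have "(\<integral>\<^sup>+x. ?D x \<partial>cube k) \<le> (\<integral>\<^sup>+x. ?D x * ?a (x k) +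
      ennreal (1/2) * (ennreal (?P x) * (1 - ?a (x k)) + ennreal (?Q x) * (1 - ?a (x k))) \<partial>cube k)"
  proof (rule nn_integral_mono_AE)
    have "AE x in cube k. ?a (x k) \<le> 1"
      using AE_cube_component[OF affinity_le_1[OF ds(1)[of k] ds(2)[of k]], of k k] step.hyps by auto
    then show "AE x in cube k. ?D x \<le> ?D x * ?a (x k) +
        ennreal (1/2) * (ennreal (?P x) * (1 - ?a (x k)) + ennreal (?Q x) * (1 - ?a (x k)))"
    proof eventually_elim
      fix x assume "?a (x k) \<le> 1"
      then have "?D x = ?D x * (?a (x k) + (1 - ?a (x k)))"
        by (simp add: add_diff_inverse_ennreal)
      also have "\<dots> = ?D x * ?a (x k) + ?D x * (1 - ?a (x k))"
        by (simp add: distrib_left)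
      also have "?D x \<le> ennreal (1/2) * (ennreal (?P x) + ennreal (?Q x))"
        using arith_geo_mean_sqrt[of "?P x" "?Q x"] nnP
        by (simp flip: ennreal_plus ennreal_mult del: ennreal_half)
      then have "?D x * (1 - ?a (x k)) \<le>
          ennreal (1/2) * (ennreal (?P x) + ennreal (?Q x)) * (1 - ?a (x k))"
        by (rule mult_right_mono) simp
      finally show "?D x \<le> ?D x * ?a (x k) +
          ennreal (1/2) * (ennreal (?P x) * (1 - ?a (x k)) + ennreal (?Q x) * (1 - ?a (x k)))"
        by (simp add: algebra_simps add_left_mono del: ennreal_half)
    qed
  qed
  also have "\<dots> = (\<integral>\<^sup>+x. ?D x * ?a (x k) \<partial>cube k) + ennreal (1/2) *
      ((\<integral>\<^sup>+x. ennreal (?P x) * (1 - ?a (x k)) \<partial>cube k) +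
       (\<integral>\<^sup>+x. ennreal (?Q x) * (1 - ?a (x k)) \<partial>cube k))"
    by (simp add: nn_integral_add nn_integral_cmult del: ennreal_half)
  \<comment> \<open>Coordinate \<open>k\<close> has law \<open>M\<close> under either density, so
    both integrals equal the same defect \<open>?T\<close>.\<close>
  also have "(\<integral>\<^sup>+x. ennreal (?P x) * (1 - ?a (x k)) \<partial>cube k) = ?T"
    using ds step.hyps by (intro nn_integral_path_density_marginal[where h = "\<lambda>u. 1 - ?a u"]) auto
  also have "(\<integral>\<^sup>+x. ennreal (?Q x) * (1 - ?a (x k)) \<partial>cube k) = ?T"
    using ds step.hyps by (intro nn_integral_path_density_marginal[where h = "\<lambda>u. 1 - ?a u"]) auto
  also have "ennreal (1/2) * (?T + ?T) = ?T" by (rule ennreal_half_mult_add_self)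
  finally have "(\<integral>\<^sup>+x. ?D x \<partial>cube k) + (\<Sum>j=1..<k. \<integral>\<^sup>+x. 1 - affinity (\<phi> j) (\<psi> j) x \<partial>M) \<le>
      (\<integral>\<^sup>+x. ?D x * ?a (x k) \<partial>cube k) + ?T + (\<Sum>j=1..<k. \<integral>\<^sup>+x. 1 - affinity (\<phi> j) (\<psi> j) x \<partial>M)"
    by (rule add_right_mono)
  with step.IH have "1 \<le> \<dots>" by (rule order_trans)
  then show ?case using step.hyps unfolding H by (simp add: ac_simps)
qed

lemma nn_integral_path_density_eq_1:
  assumes ds: "\<And>j. doubly_stochastic (\<phi> j)" and "k \<ge> 1"
  shows "(\<integral>\<^sup>+x. ennreal (path_density \<phi> k x) \<partial>cube k) = 1"
  using nn_integral_path_density_marginal[OF assms, of "\<lambda>_. 1"] by (simp add: emeasure_space_1)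

text \<open>Write P and Q for the two path densities. On the set in question P is at most 4 (sqrt P
  - sqrt Q)^2, and the integral of this square over the whole cube is 8 minus 8 times the Hellinger
  integral.\<close>

lemma path_density_tail_le:
  assumes ds: "\<And>j. doubly_stochastic (\<phi> j)" "\<And>j. doubly_stochastic (\<psi> j)" and "k \<ge> 1"
  shows "(\<integral>\<^sup>+x\<in>{x. path_density \<phi> k x \<ge> 4 * path_density \<psi> k x}. ennreal (path_density \<phi> k x) \<partial>cube k)
    \<le> 8 * (\<Sum>j=1..<k. \<integral>\<^sup>+x. 1 - affinity (\<phi> j) (\<psi> j) x \<partial>M)"
proof -
  note [measurable] = doubly_stochasticD(1)[OF ds(1)] doubly_stochasticD(1)[OF ds(2)]
    and nn = doubly_stochasticD(2)[OF ds(1)] doubly_stochasticD(2)[OF ds(2)]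
  let ?P = "path_density \<phi> k" and ?Q = "path_density \<psi> k"
  let ?A = "{x. ?P x \<ge> 4 * ?Q x}"
  let ?H = "\<integral>\<^sup>+x. ennreal (sqrt (?P x * ?Q x)) \<partial>cube k"
  let ?S = "\<Sum>j=1..<k. \<integral>\<^sup>+x. 1 - affinity (\<phi> j) (\<psi> j) x \<partial>M"
  have [measurable]: "?P \<in> borel_measurable (cube k)" "?Q \<in> borel_measurable (cube k)"
    by (rule measurable_path_density[OF doubly_stochasticD(1)[OF ds(1)]] measurable_path_density[OF doubly_stochasticD(1)[OF ds(2)]], simp)+
  have nnP: "0 \<le> ?P x" "0 \<le> ?Q x" for x by (auto intro!: path_density_nonneg nn)
  \<comment> \<open>This is the bound by 4 (sqrt P - sqrt Q)^2 with the mixed term moved to the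
    left, so that it transfers to \<open>ennreal\<close>.\<close>
  have pointwise: "?P x * indicator ?A x + 8 * sqrt (?P x * ?Q x) \<le> 4 * ?P x + 4 * ?Q x" for x
  proof -
    define a b where "a = sqrt (?P x)" and "b = sqrt (?Q x)"
    have ab: "?P x = a\<^sup>2" "?Q x = b\<^sup>2" "sqrt (?P x * ?Q x) = a * b" "0 \<le> a" "0 \<le> b"
      using nnP[of x] by (auto simp: a_def b_def real_sqrt_mult)
    show ?thesis
    proof (cases "x \<in> ?A")
      case True
      then have "(2 * b)\<^sup>2 \<le> a\<^sup>2" using ab by (simp add: power_mult_distrib)
      then have "2 * b \<le> a" using ab(4) by (rule power2_le_imp_le)
      \<comment> \<open>From 2 b \<le> a follows a \<le> 2 (a - b).\<close>
      then have "a\<^sup>2 \<le> (2 * (a - b))\<^sup>2" using ab by (intro power_mono) auto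
      then show ?thesis using True ab by (simp add: power2_eq_square algebra_simps)
    next
      case False
      have "0 \<le> 4 * (a - b)\<^sup>2" by simp
      then show ?thesis using False ab by (simp add: power2_eq_square algebra_simps)
    qed
  qed
  have [measurable]: "Measurable.pred (cube k) (\<lambda>x. 4 * ?Q x \<le> ?P x)"
    unfolding pred_def by (rule borel_measurable_le) measurable
  have "(\<integral>\<^sup>+x\<in>?A. ennreal (?P x) \<partial>cube k) + 8 * ?H =
      (\<integral>\<^sup>+x. ennreal (?P x) * indicator ?A x + 8 * ennreal (sqrt (?P x * ?Q x)) \<partial>cube k)"
    by (simp add: nn_integral_add nn_integral_cmult)
  also have "\<dots> \<le> (\<integral>\<^sup>+x. 4 * ennreal (?P x) + 4 * ennreal (?Q x) \<partial>cube k)"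
  proof (rule nn_integral_mono)
    fix x
    have "ennreal (?P x) * indicator ?A x + 8 * ennreal (sqrt (?P x * ?Q x)) =
        ennreal (?P x * indicator ?A x + 8 * sqrt (?P x * ?Q x))"
      using nnP[of x] by (auto simp: ennreal_mult indicator_def)
    also have "\<dots> \<le> ennreal (4 * ?P x + 4 * ?Q x)" by (rule ennreal_leI[OF pointwise])
    also have "\<dots> = 4 * ennreal (?P x) + 4 * ennreal (?Q x)"
      using nnP[of x] by (simp add: ennreal_mult)
    finally show "ennreal (?P x) * indicator ?A x + 8 * ennreal (sqrt (?P x * ?Q x)) \<le>
        4 * ennreal (?P x) + 4 * ennreal (?Q x)" .
  qed
  also have "\<dots> = 8"
    using assms by (simp add: nn_integral_add nn_integral_cmult nn_integral_path_density_eq_1)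
  finally have le_8: "(\<integral>\<^sup>+x\<in>?A. ennreal (?P x) \<partial>cube k) + 8 * ?H \<le> 8" .
  note le_8
  also have "8 \<le> 8 * (?H + ?S)"
    using mult_left_mono[OF one_le_hellinger_path_density[OF assms], of 8] by simp
  finally have le: "8 * ?H + (\<integral>\<^sup>+x\<in>?A. ennreal (?P x) \<partial>cube k) \<le> 8 * ?H + 8 * ?S"
    by (simp only: distrib_left ac_simps)
  \<comment> \<open>Cancelling \<open>8 * ?H\<close> in \<open>ennreal\<close> requires that it be
    finite.\<close>
  have "8 * ?H \<le> 8"
    using le_8 by (rule order_trans[rotated]) simp
  then have "8 * ?H < \<top>" by (rule le_less_trans) simp
  then have "8 * ?H \<noteq> \<top>" by (rule less_imp_neq)
  then show ?thesis using le unfolding ennreal_add_left_cancel_le infinity_ennreal_def by blast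
qed

lemma nn_integral_exp_affinity_le:
  assumes ds: "doubly_stochastic f" "doubly_stochastic g"
    and t: "(\<integral>\<^sup>+x. 1 - affinity f g x \<partial>M) = ennreal t" "0 \<le> t"
  shows "(\<integral>\<^sup>+x. ennreal (exp (enn2real (affinity f g x) - 1)) \<partial>M) \<le> ennreal (exp (- (t / 2)))"
proof -
  note [measurable] = ds[THEN doubly_stochasticD(1)]
  let ?a = "affinity f g" and ?I = "\<integral>\<^sup>+x. ennreal (exp (enn2real (affinity f g x) - 1)) \<partial>M"
  have ineq: "exp (u - 1) + (1 - u) / 2 \<le> 1" if "0 \<le> u" "u \<le> 1" for u :: real
  proof -
    have "1 + (1 - u) \<le> exp (1 - u)" by (rule exp_ge_add_one_self)
    then have "inverse (exp (1 - u)) \<le> inverse (2 - u)"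
      using that by (intro le_imp_inverse_le) auto
    then have "exp (u - 1) \<le> 1 / (2 - u)"
      using exp_minus[of "1 - u"] by (simp add: inverse_eq_divide)
    also have "\<dots> \<le> 1 - (1 - u) / 2"
    proof -
      \<comment> \<open>After clearing the denominators 2 and 2 - u, the claim is exactly this
        inequality.\<close>
      have "0 \<le> u * (1 - u)" using that by simp
      then show ?thesis using that by (simp add: field_simps)
    qed
    finally show ?thesis by simp
  qed
  have "?I + ennreal (t / 2) = (\<integral>\<^sup>+x. ennreal (exp (enn2real (?a x) - 1)) + ennreal (1/2) * (1 - ?a x) \<partial>M)"
    using t by (simp add: nn_integral_add nn_integral_cmult flip: ennreal_mult del: ennreal_half)
  also have "\<dots> \<le> (\<integral>\<^sup>+x. 1 \<partial>M)"
  proof (rule nn_integral_mono_AE)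
    show "AE x in M. ennreal (exp (enn2real (?a x) - 1)) + ennreal (1/2) * (1 - ?a x) \<le> 1"
      using affinity_le_1[OF ds]
    proof eventually_elim
      fix x assume "?a x \<le> 1"
      then obtain u where u: "?a x = ennreal u" "0 \<le> u" "u \<le> 1"
        by (cases "?a x") (auto simp: top_unique)
      have "ennreal (1/2) * (1 - ennreal u) = ennreal ((1 - u) / 2)"
        using u by (simp add: ennreal_minus flip: ennreal_1 ennreal_mult del: ennreal_half)
      then show "ennreal (exp (enn2real (?a x) - 1)) + ennreal (1/2) * (1 - ?a x) \<le> 1"
        using ineq[OF u(2,3)] u by (simp flip: ennreal_plus del: ennreal_half)
    qed
  qed
  finally have le: "?I + ennreal (t / 2) \<le> 1" by (simp add: emeasure_space_1)
  then obtain i where i: "?I = ennreal i" "0 \<le> i"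
    by (cases ?I) (auto simp: top_unique)
  with le t have "i + t / 2 \<le> 1" by (simp flip: ennreal_plus)
  with exp_ge_add_one_self[of "- (t / 2)"] have "i \<le> exp (- (t / 2))" by linarith
  then show ?thesis by (simp add: i)
qed

text \<open>The total mass 1 is split at level \<open>r\<close>. Below \<open>r\<close>, the density
  is at most a / 4 + 4 r^2 b, where a b is its square root, a has integral at most 1 and b has a
  small integral.\<close>

lemma one_le_path_density_tail:
  assumes ds: "\<And>j. doubly_stochastic (\<phi> j)" and "k \<ge> 1" and r: "r \<ge> 1"
    and t: "\<And>j. (\<integral>\<^sup>+x. 1 - affinity (\<phi> j) (\<lambda>_. 1) x \<partial>M) = ennreal (t j)" "\<And>j. 0 \<le> t j"
  shows "1 \<le> (\<integral>\<^sup>+x\<in>{x. path_density \<phi> k x \<ge> r}. ennreal (path_density \<phi> k x) \<partial>cube k) +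
      ennreal (1/4) + ennreal (4 * r\<^sup>2 * exp (- ((\<Sum>j=1..<k. t j) / 2)))"
proof -
  interpret P: product_prob_space "\<lambda>_::nat. M" "{}" by (rule product_prob_space_const)
  note [measurable] = doubly_stochasticD(1)[OF ds]
    and nn = doubly_stochasticD(2)[OF ds]
  let ?P = "path_density \<phi> k" and ?g = "\<lambda>j. affinity (\<phi> j) (\<lambda>_. 1)"
  \<comment> \<open>\<open>enn2real\<close> keeps \<open>e j\<close> real and positive even at
    points where the affinity is infinite, so division by it is always harmless.\<close>
  define e where "e j x = exp (enn2real (?g j x) - 1)" for j x
  \<comment> \<open>Dividing by \<open>e j\<close> makes the root a sub-Markov kernel: its row
    integral is u / exp (u - 1) with u the affinity, and exp (u - 1) \<ge> u.\<close>
  define \<kappa> where "\<kappa> j p = sqrt (\<phi> j p) / e j (fst p)" for j p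
  define b where "b x = (\<Prod>j=1..<k. e j (x j))" for x
  let ?a = "path_density \<kappa> k"
  have [measurable]: "e j \<in> borel_measurable M" for j unfolding e_def by measurable
  have [measurable]: "\<kappa> j \<in> borel_measurable (M \<Otimes>\<^sub>M M)" for j unfolding \<kappa>_def by measurable
  have [measurable]: "?P \<in> borel_measurable (cube k)" "?a \<in> borel_measurable (cube k)"
    by (rule measurable_path_density[OF doubly_stochasticD(1)[OF ds]], simp) (rule measurable_path_density, auto)
  have [measurable]: "b \<in> borel_measurable (cube k)"
    unfolding b_def
  proof (rule borel_measurable_prod)
    fix j assume "j \<in> {1..<k}"
    then have [measurable]: "(\<lambda>x. x j) \<in> cube k \<rightarrow>\<^sub>M M"
      by (auto intro!: measurable_cube_component)
    show "(\<lambda>x. e j (x j)) \<in> borel_measurable (cube k)" by measurable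
  qed
  have e_pos: "0 < e j x" for j x by (simp add: e_def)
  have \<kappa>_nn: "0 \<le> \<kappa> j p" for j p using nn e_pos[of j "fst p"] by (simp add: \<kappa>_def)
  have nnP: "0 \<le> ?P x" "0 \<le> ?a x" "0 \<le> b x" for x
    by (auto intro!: path_density_nonneg nn \<kappa>_nn prod_nonneg less_imp_le[OF e_pos] simp: b_def)
  have root: "sqrt (?P x) = ?a x * b x" for x
  proof -
    have "?a x * b x = path_density (\<lambda>j p. sqrt (\<phi> j p)) k x"
      using e_pos[THEN less_imp_neq] by (simp add: path_density_def b_def \<kappa>_def flip: prod.distrib)
    then show ?thesis by (simp add: path_density_sqrt)
  qed
  have int_a: "(\<integral>\<^sup>+x. ennreal (?a x) \<partial>cube k) \<le> 1"
  proof (rule nn_integral_path_density_le_1[OF _ \<kappa>_nn _ \<open>k \<ge> 1\<close>])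
    fix j
    show "AE x in M. (\<integral>\<^sup>+y. ennreal (\<kappa> j (x, y)) \<partial>M) \<le> 1"
      using AE_space affinity_le_1[OF ds doubly_stochastic_const_1, of j]
    proof eventually_elim
      fix x assume [measurable]: "x \<in> space M" and "?g j x \<le> 1"
      then obtain u where u: "?g j x = ennreal u" "0 \<le> u"
        by (cases "?g j x") (auto simp: top_unique)
      have "(\<integral>\<^sup>+y. ennreal (\<kappa> j (x, y)) \<partial>M) =
          (\<integral>\<^sup>+y. ennreal (1 / e j x) * ennreal (sqrt (\<phi> j (x, y))) \<partial>M)"
        using e_pos[of j x] nn by (simp add: \<kappa>_def flip: ennreal_mult)
      also have "\<dots> = ennreal (1 / e j x) * ?g j x"
        by (simp add: nn_integral_cmult affinity_def)
      also have "\<dots> = ennreal (u / exp (u - 1))"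
        using u by (simp add: e_def flip: ennreal_mult)
      also have "\<dots> \<le> 1"
        using exp_ge_add_one_self[of "u - 1"] by simp
      finally show "(\<integral>\<^sup>+y. ennreal (\<kappa> j (x, y)) \<partial>M) \<le> 1" .
    qed
  qed measurable
  have int_b: "(\<integral>\<^sup>+x. ennreal (b x) \<partial>cube k) \<le> ennreal (exp (- ((\<Sum>j=1..<k. t j) / 2)))"
  proof -
    \<comment> \<open>There are \<open>k\<close> coordinates but only \<open>k - 1\<close> factors
      of \<open>b\<close>; the last coordinate receives the factor 1 so that the product formula for
      integrals applies.\<close>
    let ?E = "\<lambda>j x. if j < k then ennreal (e j x) else 1"
    have split: "(\<Prod>j\<in>{1..k}. if j < k then F j else 1) = (\<Prod>j=1..<k. F j)" for F :: "nat \<Rightarrow> ennreal"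
      by (rule prod.mono_neutral_cong_right) auto
    have "(\<integral>\<^sup>+x. ennreal (b x) \<partial>cube k) = (\<integral>\<^sup>+x. (\<Prod>j\<in>{1..k}. ?E j (x j)) \<partial>cube k)"
      unfolding split b_def using e_pos by (simp add: prod_ennreal less_imp_le)
    also have "\<dots> = (\<Prod>j\<in>{1..k}. \<integral>\<^sup>+x. ?E j x \<partial>M)"
      unfolding cube_def by (rule P.product_nn_integral_prod) auto
    also have "\<dots> = (\<Prod>j\<in>{1..k}. if j < k then \<integral>\<^sup>+x. ennreal (e j x) \<partial>M else 1)"
      by (intro prod.cong) (auto simp: emeasure_space_1)
    also have "\<dots> = (\<Prod>j=1..<k. \<integral>\<^sup>+x. ennreal (e j x) \<partial>M)" by (rule split)
    also have "\<dots> \<le> (\<Prod>j=1..<k. ennreal (exp (- (t j / 2))))"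
      unfolding e_def
      by (intro prod_mono_ennreal nn_integral_exp_affinity_le ds doubly_stochastic_const_1 t)
    also have "\<dots> = ennreal (\<Prod>j=1..<k. exp (- (t j / 2)))"
      by (rule prod_ennreal) simp
    also have "(\<Prod>j=1..<k. exp (- (t j / 2))) = exp (\<Sum>j=1..<k. - (t j / 2))"
      by (simp add: exp_sum)
    also have "(\<Sum>j=1..<k. - (t j / 2)) = - ((\<Sum>j=1..<k. t j) / 2)"
      by (simp add: sum_negf sum_divide_distrib)
    finally show ?thesis .
  qed
  have pointwise: "?P x \<le> ?P x * indicator {x. ?P x \<ge> r} x + (1/4 * ?a x + 4 * r\<^sup>2 * b x)" for x
  proof (cases "?P x \<ge> r")
    case False
    have "?P x \<le> 1/4 * ?a x + 4 * r\<^sup>2 * b x"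
    \<comment> \<open>If b is small, sqrt P \<le> r gives P \<le> r sqrt P = r a b \<le> a / 4.
      Otherwise 1 < 4 r b, and P < r gives P \<le> 4 r^2 b.\<close>
    proof (cases "b x * (4 * r) \<le> 1")
      case True
      have "?P x = sqrt (?P x) * sqrt (?P x)" using nnP by simp
      also have "\<dots> \<le> r * sqrt (?P x)"
        using False r nnP[of x] by (intro mult_right_mono real_le_lsqrt) (auto simp: power2_eq_square intro: order_trans[of _ r] mult_left_mono[of 1 r r, simplified])
      also have "\<dots> = 1/4 * (?a x * (b x * (4 * r)))" by (simp add: root)
      also have "\<dots> \<le> 1/4 * (?a x * 1)" using True nnP by (intro mult_left_mono) auto
      finally show ?thesis using nnP[of x] r by (simp add: add_increasing2)
    next
      case b: False
      have "?P x \<le> r * 1" using False by simp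
      also have "\<dots> \<le> r * (b x * (4 * r))" using b r by (intro mult_left_mono) auto
      finally show ?thesis using nnP[of x] by (simp add: power2_eq_square algebra_simps)
    qed
    then show ?thesis using False by simp
  qed (use nnP r in simp)
  have "1 = (\<integral>\<^sup>+x. ennreal (?P x) \<partial>cube k)"
    using nn_integral_path_density_eq_1[OF ds \<open>k \<ge> 1\<close>] by simp
  also have "\<dots> \<le> (\<integral>\<^sup>+x. ennreal (?P x) * indicator {x. ?P x \<ge> r} x +
      (ennreal (1/4) * ennreal (?a x) + ennreal (4 * r\<^sup>2) * ennreal (b x)) \<partial>cube k)"
  proof (rule nn_integral_mono)
    fix x
    have "ennreal (?P x) \<le> ennreal (?P x * indicator {x. ?P x \<ge> r} x + (1/4 * ?a x + 4 * r\<^sup>2 * b x))"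
      by (rule ennreal_leI[OF pointwise])
    also have "\<dots> = ennreal (?P x) * indicator {x. ?P x \<ge> r} x +
        (ennreal (1/4) * ennreal (?a x) + ennreal (4 * r\<^sup>2) * ennreal (b x))"
      using nnP[of x] by (simp add: ennreal_mult[symmetric] ennreal_plus[symmetric] indicator_def del: ennreal_plus)
    finally show "ennreal (?P x) \<le> ennreal (?P x) * indicator {x. ?P x \<ge> r} x +
        (ennreal (1/4) * ennreal (?a x) + ennreal (4 * r\<^sup>2) * ennreal (b x))" .
  qed
  also have "\<dots> = (\<integral>\<^sup>+x\<in>{x. ?P x \<ge> r}. ennreal (?P x) \<partial>cube k) +
      (ennreal (1/4) * (\<integral>\<^sup>+x. ennreal (?a x) \<partial>cube k) + ennreal (4 * r\<^sup>2) * (\<integral>\<^sup>+x. ennreal (b x) \<partial>cube k))"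
    by (simp add: nn_integral_add nn_integral_cmult)
  also have "\<dots> \<le> (\<integral>\<^sup>+x\<in>{x. ?P x \<ge> r}. ennreal (?P x) \<partial>cube k) +
      (ennreal (1/4) * 1 + ennreal (4 * r\<^sup>2) * ennreal (exp (- ((\<Sum>j=1..<k. t j) / 2))))"
    by (intro add_left_mono add_mono mult_left_mono int_a int_b) auto
  finally show ?thesis by (simp add: ennreal_mult add.assoc)
qed

lemma nn_integral_one_minus_affinity_self:
  assumes "doubly_stochastic f"
  shows "(\<integral>\<^sup>+x. 1 - affinity f f x \<partial>M) = 0"
proof -
  have "(\<integral>\<^sup>+x. 1 - affinity f f x \<partial>M) = (\<integral>\<^sup>+x. 0 \<partial>M)"
    using doubly_stochasticD(3)[OF assms]
    by (intro nn_integral_cong_AE, eventually_elim)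
       (simp add: affinity_def doubly_stochasticD(2)[OF assms])
  then show ?thesis by simp
qed

lemma nn_integral_one_minus_affinity:
  assumes ds: "doubly_stochastic f" "doubly_stochastic g"
    and \<rho>: "(\<integral>\<^sup>+x. affinity f g x \<partial>M) = ennreal \<rho>" "0 \<le> \<rho>"
  shows "(\<integral>\<^sup>+x. 1 - affinity f g x \<partial>M) = ennreal (1 - \<rho>)" "\<rho> \<le> 1"
proof -
  note [measurable] = ds[THEN doubly_stochasticD(1)]
  have "(\<integral>\<^sup>+x. 1 - affinity f g x \<partial>M) = (\<integral>\<^sup>+x. 1 \<partial>M) - (\<integral>\<^sup>+x. affinity f g x \<partial>M)"
    using \<rho> affinity_le_1[OF ds] by (intro nn_integral_diff) auto
  then show "(\<integral>\<^sup>+x. 1 - affinity f g x \<partial>M) = ennreal (1 - \<rho>)"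
    using \<rho> ennreal_minus[of \<rho> 1] by (simp add: emeasure_space_1)
  have "(\<integral>\<^sup>+x. affinity f g x \<partial>M) \<le> (\<integral>\<^sup>+x. 1 \<partial>M)"
    by (intro nn_integral_mono_AE affinity_le_1 ds)
  then show "\<rho> \<le> 1" using \<rho> by (simp add: emeasure_space_1)
qed

end

section \<open>Lebesgue measure on the unit interval\<close>

abbreviation unit_interval :: "real measure" where
  "unit_interval \<equiv> restrict_space lborel {0..1}"

abbreviation unit_square :: "(real \<times> real) set" where
  "unit_square \<equiv> {0..1} \<times> {0..1}"

interpretation unit_interval: prob_space unit_interval
  by (rule prob_spaceI) (simp add: emeasure_restrict_space space_restrict_space)

lemma unit_cube_eq: "unit_cube k = unit_interval.cube k"
  by (simp add: unit_cube_def unit_interval.cube_def)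

lemma borel_measurable_unit_interval_pair:
  assumes [measurable]: "f \<in> borel_measurable (borel :: (real \<times> real) measure)"
  shows "f \<in> borel_measurable (unit_interval \<Otimes>\<^sub>M unit_interval)"
proof -
  have [measurable]: "(\<lambda>x. x) \<in> unit_interval \<rightarrow>\<^sub>M borel"
    by (intro measurable_restrict_space1) simp
  have "(\<lambda>p. f (fst p, snd p)) \<in> borel_measurable (unit_interval \<Otimes>\<^sub>M unit_interval)"
    by measurable
  then show ?thesis by simp
qed

text \<open>Links iterated integrals over the interval, used for chains, to the planar integral in
  the series. As \<open>F\<close> vanishes off the square, the restrictions cost nothing.\<close>

lemma nn_integral_unit_interval_pair:
  assumes [measurable]: "F \<in> borel_measurable (borel :: (real \<times> real) measure)"
    and zero: "\<And>p. p \<notin> unit_square \<Longrightarrow> F p = 0"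
  shows "(\<integral>\<^sup>+x. \<integral>\<^sup>+y. F (x, y) \<partial>unit_interval \<partial>unit_interval) = (\<integral>\<^sup>+p. F p \<partial>lborel)"
proof -
  have [measurable]: "F \<in> borel_measurable (lborel \<Otimes>\<^sub>M lborel)"
    by (simp add: lborel_prod)
  have "(\<integral>\<^sup>+x. \<integral>\<^sup>+y. F (x, y) \<partial>unit_interval \<partial>unit_interval) =
      (\<integral>\<^sup>+x. (\<integral>\<^sup>+y. F (x, y) * indicator {0..1} y \<partial>lborel) * indicator {0..1} x \<partial>lborel)"
    by (simp add: nn_integral_restrict_space)
  also have "\<dots> = (\<integral>\<^sup>+x. \<integral>\<^sup>+y. F (x, y) \<partial>lborel \<partial>lborel)"
  proof (intro nn_integral_cong)
    fix x :: real
    have "(\<integral>\<^sup>+y. F (x, y) * indicator {0..1} y \<partial>lborel) = (\<integral>\<^sup>+y. F (x, y) \<partial>lborel)"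
      by (intro nn_integral_cong) (auto simp: indicator_def zero)
    moreover have "(\<integral>\<^sup>+y. F (x, y) \<partial>lborel) = 0" if "x \<notin> {0..1}"
    proof -
      have "F (x, y) = 0" for y using that by (intro zero) auto
      then show ?thesis by simp
    qed
    ultimately show "(\<integral>\<^sup>+y. F (x, y) * indicator {0..1} y \<partial>lborel) * indicator {0..1} x =
        (\<integral>\<^sup>+y. F (x, y) \<partial>lborel)"
      by (auto simp: indicator_def)
  qed
  also have "\<dots> = (\<integral>\<^sup>+p. F p \<partial>lborel)"
    using lborel.nn_integral_fst[of F lborel] by (simp add: lborel_prod)
  finally show ?thesis .
qed

text \<open>A measure is determined by its distribution function, here the uniform one, and a
  density is determined by its measure up to null sets.\<close>

lemma AE_unit_interval_eq_1:
  assumes G: "G \<in> borel_measurable unit_interval"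
    and int: "\<And>t. t \<in> {0..1} \<Longrightarrow> (\<integral>\<^sup>+x\<in>{..t}. G x \<partial>unit_interval) = ennreal t"
  shows "AE x in unit_interval. G x = 1"
proof -
  let ?I = "\<lambda>H t. \<integral>\<^sup>+x\<in>{..t}. H x \<partial>unit_interval"
  have I_1: "?I (\<lambda>_. 1) t = ennreal t" if "t \<in> {0..1}" for t
  proof -
    have "1 * indicator {..t} x * indicator {0..1} x = (indicator {0..t} x :: ennreal)" for x
      using that by (auto simp: indicator_def)
    then have "?I (\<lambda>_. 1) t = (\<integral>\<^sup>+x. indicator {0..t} x \<partial>lborel)"
      by (subst nn_integral_restrict_space) simp_all
    then show ?thesis using that by simp
  qed
  have below: "?I H t = 0" if "t < 0" for H t
  proof -
    have "?I H t = (\<integral>\<^sup>+x. 0 \<partial>unit_interval)"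
      using that by (intro nn_integral_cong) (auto simp: space_restrict_space)
    then show ?thesis by simp
  qed
  have above: "?I H t = ?I H 1" if "t > 1" for H t
    using that by (intro nn_integral_cong) (auto simp: space_restrict_space indicator_def)
  \<comment> \<open>Both functions vanish for \<open>t < 0\<close> and are constant for
    \<open>t > 1\<close>, so agreement on [0,1] extends to the whole line.\<close>
  have I_G: "?I G t = ?I (\<lambda>_. 1) t" for t
  proof -
    consider "t < 0" | "t \<in> {0..1}" | "t > 1" by force
    then show ?thesis
      by cases (simp_all only: below above int I_1, simp_all only: int I_1 atLeastAtMost_iff zero_le_one order_refl)
  qed
  \<comment> \<open>The density is extended by zero because distribution functions are compared for
    Borel measures on the whole line.\<close>
  define D where "D H = density lborel (\<lambda>x. H x * indicator {0..1::real} x)" for H :: "real \<Rightarrow> ennreal"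
  have meas: "(\<lambda>x. H x * indicator {0..1} x) \<in> borel_measurable lborel"
    if "H \<in> borel_measurable unit_interval" for H :: "real \<Rightarrow> ennreal"
    using that by (subst (asm) borel_measurable_restrict_space_iff_ennreal) auto
  have D_atMost: "emeasure (D H) {..t} = ?I H t" if "H \<in> borel_measurable unit_interval" for H t
    using meas[OF that] unfolding D_def
    by (subst emeasure_density) (auto simp: nn_integral_restrict_space ac_simps)
  have D_space: "emeasure (D H) (space (D H)) = ?I H 1" if "H \<in> borel_measurable unit_interval" for H
  proof -
    have "emeasure (D H) (space (D H)) = (\<integral>\<^sup>+x. H x * indicator {0..1} x \<partial>lborel)"
      using meas[OF that] unfolding D_def by (subst emeasure_density) auto
    also have "\<dots> = ?I H 1"
      by (subst nn_integral_restrict_space) (auto intro!: nn_integral_cong simp: indicator_def)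
    finally show ?thesis .
  qed
  have fin: "finite_borel_measure (D H)" if "H \<in> borel_measurable unit_interval" "?I H 1 = 1" for H
    using D_space[OF that(1)] that(2)
    by (intro finite_borel_measure.intro finite_measureI finite_borel_measure_axioms.intro)
       (auto simp: D_def)
  have "D G = D (\<lambda>_. 1)"
  proof (rule cdf_unique')
    show "finite_borel_measure (D G)" using fin[OF G] int[of 1] by simp
    show "finite_borel_measure (D (\<lambda>_. 1))" using fin[of "\<lambda>_. 1"] I_1[of 1] by simp
    show "cdf (D G) = cdf (D (\<lambda>_. 1))"
      using D_atMost[OF G] D_atMost[of "\<lambda>_. 1"] I_G by (simp add: fun_eq_iff cdf_def measure_def)
  qed
  then have "AE x in lborel. G x * indicator {0..1} x = 1 * indicator {0..1} x"
    unfolding D_def using meas[OF G] meas[of "\<lambda>_. 1"]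
    by (subst (asm) sigma_finite_measure.density_unique_iff[OF sigma_finite_lborel]) auto
  then show ?thesis
    by (subst AE_restrict_space_iff) (auto elim!: eventually_mono split: split_indicator_asm)
qed

section \<open>Two-dimensional copula densities\<close>

lemma copula_density_pair_nonneg:
  assumes "copula_density 2 (\<lambda>u. f (u 1, u 2))" "p \<in> unit_square"
  shows "0 \<le> f p"
proof -
  obtain x y where p: "p = (x, y)" by (cases p)
  have "(\<lambda>i\<in>{1..2::nat}. if i = 1 then x else y) \<in> space (unit_cube 2)"
    using assms(2) p by (auto simp: unit_cube_def space_PiM space_restrict_space)
  then show ?thesis
    using assms(1) p unfolding copula_density_def has_copula_density_def by fastforce
qed

text \<open>Evaluate the copula at the point with \<open>t\<close> in coordinate \<open>j\<close>
  and 1 elsewhere. Coordinates in the cube never exceed 1, so the lower box of this point restricts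
  coordinate \<open>j\<close> alone.\<close>

lemma copula_density_pair_marginal:
  assumes c: "copula_density 2 (\<lambda>u. f (u 1, u 2))" and j: "j \<in> {1, 2}" and t: "t \<in> {0..1}"
  shows "(\<integral>\<^sup>+u. ennreal (f (u 1, u 2)) * indicator {..t} (u j) \<partial>unit_cube 2) = ennreal t"
proof -
  obtain C where C: "copula 2 C" "has_copula_density 2 C (\<lambda>u. f (u 1, u 2))"
    using c by (auto simp: copula_density_def)
  let ?u = "\<lambda>i\<in>{1..2::nat}. if i = j then t else 1"
  have u: "?u \<in> space (unit_cube 2)"
    using t by (auto simp: unit_cube_def space_PiM space_restrict_space)
  have j': "j \<in> {1..2}" using j by auto
  have "\<forall>t\<in>{0..1}. C (\<lambda>i\<in>{1..2}. if i = j then t else 1) = t"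
    using C(1)[unfolded copula_def, THEN conjunct2] j' by (rule bspec)
  then have "C ?u = t" using t by (rule bspec)
  moreover have "ennreal (C ?u) = (\<integral>\<^sup>+u\<in>lower_box 2 ?u. ennreal (f (u 1, u 2)) \<partial>unit_cube 2)"
    using C(2)[unfolded has_copula_density_def, THEN conjunct2, THEN conjunct2] u by (rule bspec)
  ultimately have "ennreal t = (\<integral>\<^sup>+u\<in>lower_box 2 ?u. ennreal (f (u 1, u 2)) \<partial>unit_cube 2)"
    by (simp only:)
  also have "\<dots> = (\<integral>\<^sup>+u. ennreal (f (u 1, u 2)) * indicator {..t} (u j) \<partial>unit_cube 2)"
  proof (intro nn_integral_cong arg_cong2[where f = "(*)"] refl)
    fix u assume u: "u \<in> space (unit_cube 2)"
    then have "u i \<le> 1" if "i \<in> {1..2}" for i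
      using that by (auto simp: unit_cube_def space_PiM space_restrict_space PiE_iff)
    then have "u \<in> lower_box 2 ?u \<longleftrightarrow> u j \<le> t"
      using j t u unfolding lower_box_def by auto
    then show "indicator (lower_box 2 ?u) u = (indicator {..t} (u j) :: ennreal)"
      by (simp add: indicator_def)
  qed
  finally show ?thesis by simp
qed

text \<open>For each variable, integrating out the other one leaves a function with uniform
  distribution function, hence 1 almost everywhere. Extension by zero is needed because
  \<open>f\<close> is controlled on the square only.\<close>

lemma doubly_stochastic_copula_density:
  assumes cont: "continuous_on unit_square f" and c: "copula_density 2 (\<lambda>u. f (u 1, u 2))"
  shows "unit_interval.doubly_stochastic (\<lambda>p. indicator unit_square p * f p)"
proof -
  define g where "g p = indicator unit_square p * f p" for p
  have "g \<in> borel_measurable borel"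
    using borel_measurable_continuous_on_indicator[OF _ cont] by (simp add: g_def[abs_def] borel_closed closed_Times)
  then have g [measurable]: "g \<in> borel_measurable (unit_interval \<Otimes>\<^sub>M unit_interval)"
    by (rule borel_measurable_unit_interval_pair)
  have nn: "0 \<le> g p" for p
    using copula_density_pair_nonneg[OF c, of p] by (simp add: g_def indicator_def)
  have [measurable]: "indicator {..t} \<in> borel_measurable unit_interval" for t :: real
    by (intro measurable_restrict_space1) simp
  have cube: "(\<integral>\<^sup>+u. ennreal (f (u 1, u 2)) * h u \<partial>unit_cube 2) =
      (\<integral>\<^sup>+u. ennreal (g (u 1, u 2)) * h u \<partial>unit_interval.cube 2)" for h
    unfolding unit_cube_eq[symmetric]
    by (intro nn_integral_cong)
       (auto simp: unit_cube_def space_PiM space_restrict_space PiE_iff g_def)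
  have 1: "AE x in unit_interval. (\<integral>\<^sup>+y. ennreal (g (x, y)) \<partial>unit_interval) = 1"
  proof (rule AE_unit_interval_eq_1)
    fix t :: real assume t: "t \<in> {0..1}"
    have "ennreal t = (\<integral>\<^sup>+u. ennreal (g (u 1, u 2)) * indicator {..t} (u 1) \<partial>unit_interval.cube 2)"
      unfolding cube[symmetric] by (rule copula_density_pair_marginal[OF c _ t, symmetric]) simp
    also have "\<dots> = (\<integral>\<^sup>+x. \<integral>\<^sup>+y. ennreal (g (x, y)) * indicator {..t} x \<partial>unit_interval \<partial>unit_interval)"
      using unit_interval.nn_integral_cube_2[of "\<lambda>p. ennreal (g p) * indicator {..t} (fst p)"] by simp
    also have "\<dots> = (\<integral>\<^sup>+x\<in>{..t}. (\<integral>\<^sup>+y. ennreal (g (x, y)) \<partial>unit_interval) \<partial>unit_interval)"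
      by (rule nn_integral_cong) (simp add: nn_integral_multc)
    finally show "(\<integral>\<^sup>+x\<in>{..t}. (\<integral>\<^sup>+y. ennreal (g (x, y)) \<partial>unit_interval) \<partial>unit_interval) = ennreal t" ..
  qed measurable
  have 2: "AE y in unit_interval. (\<integral>\<^sup>+x. ennreal (g (x, y)) \<partial>unit_interval) = 1"
  proof (rule AE_unit_interval_eq_1)
    fix t :: real assume t: "t \<in> {0..1}"
    have "ennreal t = (\<integral>\<^sup>+u. ennreal (g (u 1, u 2)) * indicator {..t} (u 2) \<partial>unit_interval.cube 2)"
      unfolding cube[symmetric] by (rule copula_density_pair_marginal[OF c _ t, symmetric]) simp
    also have "\<dots> = (\<integral>\<^sup>+x. \<integral>\<^sup>+y. ennreal (g (x, y)) * indicator {..t} y \<partial>unit_interval \<partial>unit_interval)"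
      using unit_interval.nn_integral_cube_2[of "\<lambda>p. ennreal (g p) * indicator {..t} (snd p)"] by simp
    also have "\<dots> = (\<integral>\<^sup>+y. \<integral>\<^sup>+x. ennreal (g (x, y)) * indicator {..t} y \<partial>unit_interval \<partial>unit_interval)"
      by (rule pair_sigma_finite.Fubini'[OF unit_interval.pair_sigma_finite_self, symmetric]) measurable
    also have "\<dots> = (\<integral>\<^sup>+y\<in>{..t}. (\<integral>\<^sup>+x. ennreal (g (x, y)) \<partial>unit_interval) \<partial>unit_interval)"
      by (rule nn_integral_cong) (simp add: nn_integral_multc)
    finally show "(\<integral>\<^sup>+y\<in>{..t}. (\<integral>\<^sup>+x. ennreal (g (x, y)) \<partial>unit_interval) \<partial>unit_interval) = ennreal t" ..
  qed measurable
  have "unit_interval.doubly_stochastic g"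
    unfolding unit_interval.doubly_stochastic_def by (intro conjI allI g nn 1 2)
  then show ?thesis unfolding g_def[abs_def] .
qed

text \<open>Identifies a term of the series with the mean affinity defect relative to the
  independent density 1. Continuity on the compact square makes the root integrable, so
  \<open>\<rho>\<close> is a genuine integral and not a default value.\<close>

lemma one_minus_affinity_copula_density:
  assumes cont: "continuous_on unit_square f" and c: "copula_density 2 (\<lambda>u. f (u 1, u 2))"
  defines "\<rho> \<equiv> LINT p:unit_square|lborel. sqrt (f p)"
  shows "(\<integral>\<^sup>+x. 1 - unit_interval.affinity (\<lambda>p. indicator unit_square p * f p) (\<lambda>_. 1) x \<partial>unit_interval)
      = ennreal (1 - \<rho>)" and "\<rho> \<le> 1"
proof -
  let ?f = "\<lambda>p. indicator unit_square p * f p"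
  let ?s = "\<lambda>p. indicator unit_square p *\<^sub>R sqrt (f p)"
  have int: "integrable lborel ?s"
    by (intro borel_integrable_compact compact_Times continuous_on_real_sqrt cont) auto
  have nn: "0 \<le> ?s p" for p
    using copula_density_pair_nonneg[OF c, of p] by (simp add: indicator_def)
  have "(\<integral>\<^sup>+x. unit_interval.affinity ?f (\<lambda>_. 1) x \<partial>unit_interval) =
      (\<integral>\<^sup>+x. \<integral>\<^sup>+y. ennreal (?s (x, y)) \<partial>unit_interval \<partial>unit_interval)"
    unfolding unit_interval.affinity_def by (intro nn_integral_cong) (auto simp: indicator_def)
  also have "\<dots> = (\<integral>\<^sup>+p. ennreal (?s p) \<partial>lborel)"
    using int by (intro nn_integral_unit_interval_pair) auto
  also have "\<dots> = ennreal \<rho>"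
    unfolding \<rho>_def set_lebesgue_integral_def by (intro nn_integral_eq_integral int) (use nn in simp)
  finally have 1: "(\<integral>\<^sup>+x. unit_interval.affinity ?f (\<lambda>_. 1) x \<partial>unit_interval) = ennreal \<rho>" .
  have 2: "0 \<le> \<rho>"
    unfolding \<rho>_def set_lebesgue_integral_def using nn by (rule Bochner_Integration.integral_nonneg)
  note affinity = unit_interval.nn_integral_one_minus_affinity[OF
      doubly_stochastic_copula_density[OF cont c] unit_interval.doubly_stochastic_const_1 1 2]
  show "(\<integral>\<^sup>+x. 1 - unit_interval.affinity ?f (\<lambda>_. 1) x \<partial>unit_interval) = ennreal (1 - \<rho>)"
    by (rule affinity(1))
  show "\<rho> \<le> 1" by (rule affinity(2))
qed

section \<open>Uniform integrability and convergence of the series\<close>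

theorem corollary5p4:
  fixes \<phi> :: "nat \<Rightarrow> real \<times> real \<Rightarrow> real"
    and c :: "nat \<Rightarrow> (nat \<Rightarrow> real) \<Rightarrow> real"
  assumes "\<And>j. j \<ge> 1 \<Longrightarrow> continuous_on ({0..1} \<times> {0..1}) (\<phi> j)"
    and "\<And>j. j \<ge> 1 \<Longrightarrow> copula_density 2 (\<lambda>u. \<phi> j (u 1, u 2))"
    and "\<And>k. k \<ge> 2 \<Longrightarrow> copula_density k (c k)"
    and "\<And>k u. k \<ge> 2 \<Longrightarrow> u \<in> space (unit_cube k) \<Longrightarrow>
           c k u = (\<Prod>j=1..<k. \<phi> j (u j, u (j + 1)))"
  shows "uniformly_integrable c \<longleftrightarrow>
    summable (\<lambda>j. 1 - (LINT p:{0..1} \<times> {0..1}|lborel. sqrt (\<phi> (Suc j) p)))"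
proof -
  note cont = assms(1) and dens = assms(2) and c = assms(4)
  \<comment> \<open>The hypotheses start at index 1 while the lemmas on chains quantify over all
    indices; index 0 gets the constant density 1, whose defect is 0.\<close>
  define f where "f j p = (if j = 0 then 1 else indicator unit_square p * \<phi> j p)" for j p
  define t where "t j = (if j = 0 then 0 else 1 - (LINT p:unit_square|lborel. sqrt (\<phi> j p)))" for j
  have f_pos: "f j = (\<lambda>p. indicator unit_square p * \<phi> j p)" if "j \<ge> 1" for j
    using that by (simp add: f_def fun_eq_iff)
  have f_0: "f 0 = (\<lambda>_. 1)" by (simp add: f_def fun_eq_iff)
  have ds: "unit_interval.doubly_stochastic (f j)" for j
    using doubly_stochastic_copula_density[OF cont dens, of j] unit_interval.doubly_stochastic_const_1
    by (cases "j = 0") (simp_all add: f_0 f_pos)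
  have t: "(\<integral>\<^sup>+x. 1 - unit_interval.affinity (f j) (\<lambda>_. 1) x \<partial>unit_interval) = ennreal (t j)" "0 \<le> t j" for j
    using one_minus_affinity_copula_density[OF cont dens, of j]
      unit_interval.nn_integral_one_minus_affinity_self[OF unit_interval.doubly_stochastic_const_1]
    by (cases "j = 0"; simp add: f_0 f_pos t_def)+
  \<comment> \<open>Bounds of at least 1 are chosen so that adding factors never decreases a product
    of them.\<close>
  have f_bound: "\<exists>B\<ge>1. \<forall>p. f j p \<le> B" for j
  proof (cases "j = 0")
    case False
    then have "compact (\<phi> j ` unit_square)"
      by (intro compact_continuous_image cont compact_Times) auto
    then have "bounded (\<phi> j ` unit_square)" by (rule compact_imp_bounded)
    then obtain B where B: "\<And>p. p \<in> unit_square \<Longrightarrow> \<bar>\<phi> j p\<bar> \<le> B"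
      unfolding bounded_iff real_norm_def by blast
    have "f j p \<le> max 1 B" for p
      using False B[of p] by (cases "p \<in> unit_square") (simp_all add: f_def)
    then show ?thesis by (intro exI[of _ "max 1 B"]) auto
  qed (auto simp: f_def intro: exI[of _ 1])
  \<comment> \<open>On the cube all coordinates lie in [0,1], so the indicators inside
    \<open>f\<close> equal 1 and \<open>c k\<close> coincides with
    \<open>path_density f k\<close>.\<close>
  have tail: "(\<integral>\<^sup>+u\<in>{u \<in> space (unit_cube k). c k u \<ge> r}. ennreal (c k u) \<partial>unit_cube k) =
      (\<integral>\<^sup>+u\<in>{u. path_density f k u \<ge> r}. ennreal (path_density f k u) \<partial>unit_interval.cube k)"
    if k: "k \<ge> 2" for k and r :: real
    unfolding unit_cube_eq
  proof (rule nn_integral_cong)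
    fix u assume u: "u \<in> space (unit_interval.cube k)"
    then have "u i \<in> {0..1}" if "i \<in> {1..k}" for i
      using that by (auto simp: unit_interval.cube_def space_PiM space_restrict_space)
    then have "c k u = path_density f k u"
      using c[OF k] u unfolding unit_cube_eq path_density_def
      by (auto intro!: prod.cong simp: f_def indicator_def)
    then show "ennreal (c k u) * indicator {u \<in> space (unit_interval.cube k). r \<le> c k u} u =
        ennreal (path_density f k u) * indicator {u. r \<le> path_density f k u} u"
      using u by (simp add: indicator_def)
  qed
  have UI: "uniformly_integrable c \<longleftrightarrow> ((\<lambda>r::real. SUP k\<in>{2..}.
      \<integral>\<^sup>+u\<in>{u. path_density f k u \<ge> r}. ennreal (path_density f k u) \<partial>unit_interval.cube k)
      \<longlongrightarrow> 0) at_top" (is "_ \<longleftrightarrow> ((\<lambda>r. SUP k\<in>{2..}. ?J k r) \<longlongrightarrow> 0) at_top")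
  proof -
    have "(\<lambda>r. SUP k\<in>{2..}. \<integral>\<^sup>+u\<in>{u \<in> space (unit_cube k). c k u \<ge> r}. ennreal (c k u) \<partial>unit_cube k)
        = (\<lambda>r. SUP k\<in>{2..}. ?J k r)"
      by (intro ext SUP_cong refl tail) simp
    then show ?thesis unfolding uniformly_integrable_def by (rule arg_cong)
  qed
  have "uniformly_integrable c \<longleftrightarrow> summable (\<lambda>j. t (Suc j))"
  proof
    assume "uniformly_integrable c"
    \<comment> \<open>A tail below 1/4, together with the 1/4 in
      \<open>one_le_path_density_tail\<close>, leaves at least 1/2 for the exponential term.\<close>
    then have "\<forall>\<^sub>F r in at_top. (SUP k\<in>{2..}. ?J k r) < ennreal (1/4)"
      unfolding UI by (rule order_tendstoD) simp
    then have "\<forall>\<^sub>F r in at_top. 1 \<le> r \<and> (SUP k\<in>{2..}. ?J k r) < ennreal (1/4)"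
      by (intro eventually_conj eventually_ge_at_top)
    then obtain r where r: "r \<ge> 1" and SUP: "(SUP k\<in>{2..}. ?J k r) < ennreal (1/4)"
      using eventually_happens'[OF trivial_limit_at_top_linorder] by blast
    show "summable (\<lambda>j. t (Suc j))"
    proof (rule bounded_imp_summable)
      fix n
      \<comment> \<open>Taking \<open>k = n + 2\<close> keeps the index in the family and gives
        exactly the terms \<open>t 1\<close> to \<open>t (n + 1)\<close>.\<close>
      define s where "s = (\<Sum>j=1..<n + 2. t j)"
      have s: "s = (\<Sum>j\<le>n. t (Suc j))"
        using sum.shift_bounds_Suc_ivl[of t 0 "Suc n"]
        by (simp add: s_def lessThan_Suc_atMost[symmetric] atLeast0LessThan)
      have "?J (n + 2) r \<le> (SUP k\<in>{2..}. ?J k r)"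
        by (rule SUP_upper) simp
      with SUP have J: "?J (n + 2) r \<le> ennreal (1/4)" by simp
      have "1 \<le> ?J (n + 2) r + ennreal (1/4) + ennreal (4 * r\<^sup>2 * exp (- (s / 2)))"
        unfolding s_def
        by (rule unit_interval.one_le_path_density_tail[OF ds _ r t]) simp
      also have "\<dots> \<le> ennreal (1/4) + ennreal (1/4) + ennreal (4 * r\<^sup>2 * exp (- (s / 2)))"
        by (intro add_right_mono J)
      also have "\<dots> = ennreal (1/2 + 4 * r\<^sup>2 * exp (- (s / 2)))"
        by (simp flip: ennreal_plus del: ennreal_half)
      finally have "1/2 \<le> 4 * r\<^sup>2 * exp (- (s / 2))"
        by (simp del: ennreal_half ennreal_plus)
      \<comment> \<open>With \<open>r\<close> fixed, this bounds the partial sums independently of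
        \<open>n\<close>.\<close>
      then have "exp (s / 2) \<le> 8 * r\<^sup>2" by (simp add: exp_minus field_simps)
      moreover have "0 < 8 * r\<^sup>2" using r by simp
      ultimately have "s / 2 \<le> ln (8 * r\<^sup>2)" by (simp only: ln_ge_iff)
      then show "(\<Sum>j\<le>n. t (Suc j)) \<le> 2 * ln (8 * r\<^sup>2)" by (simp add: s)
    qed (rule t)
  next
    assume summ: "summable (\<lambda>j. t (Suc j))"
    show "uniformly_integrable c"
      unfolding UI
    proof (rule order_tendstoI)
      fix a :: ennreal assume "0 < a"
      \<comment> \<open>Since \<open>a\<close> may be infinite, a positive real below it is chosen
        first.\<close>
      then obtain b where "0 < b" "b < a" using dense by blast
      then obtain \<epsilon> where \<epsilon>: "0 < \<epsilon>" "ennreal \<epsilon> < a"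
        by (cases b) auto
      \<comment> \<open>The divisor 8 cancels the factor in
        \<open>path_density_tail_le\<close>.\<close>
      obtain N where N: "\<And>m n. m \<ge> N \<Longrightarrow> norm (\<Sum>j=m..<n. t (Suc j)) < \<epsilon> / 8"
        using summ \<epsilon>(1) unfolding summable_Cauchy by (meson divide_pos_pos zero_less_numeral)
      \<comment> \<open>The shift by one matches the series, whose \<open>j\<close>-th term is
        \<open>t (Suc j)\<close>.\<close>
      define m where "m = Suc N"
      have tail_t: "(\<Sum>j=m..<k. t j) \<le> \<epsilon> / 8" for k
      proof (cases k)
        case (Suc n)
        then show ?thesis
          using N[of N n] sum.shift_bounds_Suc_ivl[of t N n] by (simp add: m_def)
      qed (use \<epsilon> in simp)
      \<comment> \<open>\<open>path_density g k\<close> is the density \<open>c\<^sub>m\<close> viewed on the \<open>k\<close>-cube; it is bounded uniformly in \<open>k\<close>.\<close>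
      define g where "g j = (if j < m then f j else (\<lambda>_. 1))" for j
      have ds_g: "unit_interval.doubly_stochastic (g j)" for j
        using ds unit_interval.doubly_stochastic_const_1 by (simp add: g_def)
      \<comment> \<open>Below \<open>m\<close> the two kernels coincide and the defect vanishes;
        from \<open>m\<close> on the comparison is with the constant 1. Only a tail of the series
        remains.\<close>
      have aff: "(\<integral>\<^sup>+x. 1 - unit_interval.affinity (f j) (g j) x \<partial>unit_interval) =
          ennreal (if j < m then 0 else t j)" for j
        using t(1)[of j] unit_interval.nn_integral_one_minus_affinity_self[OF ds, of j]
        by (simp add: g_def)
      have small: "(\<Sum>j=1..<k. \<integral>\<^sup>+x. 1 - unit_interval.affinity (f j) (g j) x \<partial>unit_interval)
          \<le> ennreal (\<epsilon> / 8)" for k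
      proof -
        have "(\<Sum>j=1..<k. if j < m then 0 else t j) = (\<Sum>j=m..<k. t j)"
          by (rule sum.mono_neutral_cong_right) (auto simp: m_def)
        then show ?thesis
          unfolding aff using tail_t[of k] t(2) by (subst sum_ennreal) (auto intro: ennreal_leI)
      qed
      obtain b where b: "\<And>j. 1 \<le> b j" "\<And>j p. f j p \<le> b j" using f_bound by metis
      define B where "B = (\<Prod>j<m. b j)"
      have g_bound: "path_density g k u \<le> B" for k u
      proof -
        have "path_density g k u \<le> (\<Prod>j=1..<k. if j < m then b j else 1)"
          unfolding path_density_def
          using unit_interval.doubly_stochasticD(2)[OF ds_g] b by (intro prod_mono) (auto simp: g_def)
        also have "\<dots> = (\<Prod>j\<in>{1..<k} \<inter> {..<m}. b j)"
          by (rule prod.mono_neutral_cong_right) auto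
        \<comment> \<open>The index set grows to all of \<open>{..<m}\<close>, which is allowed as
          every \<open>b j\<close> is at least 1; the bound thus no longer depends on
          \<open>k\<close>.\<close>
        also have "\<dots> \<le> B"
          unfolding B_def by (intro prod_mono2) (auto intro: b order_trans[OF zero_le_one])
        finally show ?thesis .
      qed
      have "(SUP k\<in>{2..}. ?J k r) < a" if r: "r \<ge> 4 * B" for r
      proof -
        have "?J k r \<le> ennreal \<epsilon>" if "k \<in> {2..}" for k
        proof -
          \<comment> \<open>At a level \<open>r\<close> of at least \<open>4 * B\<close>, a value
            above \<open>r\<close> exceeds four times the bounded comparison density, so the tail
            set lies in the set of \<open>path_density_tail_le\<close>.\<close>
          have "?J k r \<le> (\<integral>\<^sup>+u\<in>{u. path_density f k u \<ge> 4 * path_density g k u}.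
              ennreal (path_density f k u) \<partial>unit_interval.cube k)"
          proof (intro nn_integral_mono mult_left_mono)
            fix u
            show "indicator {u. r \<le> path_density f k u} u \<le>
                (indicator {u. 4 * path_density g k u \<le> path_density f k u} u :: ennreal)"
              using g_bound[of k u] r by (auto simp: indicator_def)
          qed simp
          also have "\<dots> \<le> 8 * ennreal (\<epsilon> / 8)"
            using that
            by (intro order_trans[OF unit_interval.path_density_tail_le[OF ds ds_g]] mult_left_mono small) auto
          also have "\<dots> = ennreal \<epsilon>"
            using \<epsilon>(1) ennreal_mult[of 8 "\<epsilon> / 8"] by simp
          finally show ?thesis .
        qed
        then have "(SUP k\<in>{2..}. ?J k r) \<le> ennreal \<epsilon>" by (rule SUP_least)
        then show ?thesis using \<epsilon>(2) by (rule order_le_less_trans)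
      qed
      then show "\<forall>\<^sub>F r in at_top. (SUP k\<in>{2..}. ?J k r) < a"
        unfolding eventually_at_top_linorder by blast
    qed simp
  qed
  then show ?thesis by (simp add: t_def)
qed

end
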